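(* Let $d\in\mathbb{R}_{>0}$, $d_s\in\mathbb{R}_{\ge 0}$, and let $\mathcal{U}$ be a $(d,d_s)$-minimal $(c,\ell,d,d_s)$-CA model. Then $\ell$ and $c$ are integer combinations of $d$ and $d_s$, i.e., there are integers $a,b,a',b'$ with $\ell=ad+bd_s$ and $c=a'd+b'd_s$.
   Context: A PCA model is a pair $(C,\mathcal{A})$ where $C$ is a circle with a distinguished point $0$ and $\mathcal{A}$ is a finite family of open arcs of $C$, none contained in another, no two of which cover $C$. Each arc $A$ is the open arc going clockwise from $s(A)$ to $t(A)$; these are its extremes. For points $p,q$ of $C$, $|p,q|$ is the length of the clockwise open arc from $p$ to $q$. An ordered pair $e_1e_2$ of extremes of the model is consecutive if no extreme lies strictly between them clockwise. Two PCA models are equivalent if there is a bijection $f$ between their arc families such that for all arcs $A,B$ and $e,e'\in\{s,t\}$, $e(f(A))$ precedes $e'(f(B))$ in the clockwise traversal from $0$ iff $e(A)$ precedes $e'(B)$. For $u=(c,\ell,d,d_s)$ with $c,\ell,d>0$, $d_s\ge 0$, a $u$-CA (or $(c,\ell,d,d_s)$-CA) model is a PCA model with $|C|=c$, all arcs of length $\ell$, $|e,e'|\ge d$ for all consecutive extremes $e,e'$, and $|s(A),s(A')|\ge d+d_s$ for all distinct arcs $A,A'$. A $(c,\ell,d,d_s)$-CA model $\mathcal{U}$ is $(d,d_s)$-minimal if $\ell\le\ell'$ and $c\le c'$ for every $(c',\ell',d,d_s)$-CA model equivalent to $\mathcal{U}$. *)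

theory Defs
  imports Complex_Main
begin

text \<open>
  A circle of length \<open>c\<close> with distinguished point \<open>0\<close> is coordinatised by the clockwise
  distance from \<open>0\<close>, so its points are the reals in \<open>[0, c)\<close>.
\<close>

definition circle :: "real \<Rightarrow> real set" where
  "circle c = {0..<c}"

text \<open>Both notions below are meant for \<open>p\<close>, \<open>q\<close> on the circle; for \<open>p = q\<close> the arc
  from \<open>p\<close> to \<open>q\<close> is empty and has length \<open>0\<close>.\<close>

definition cw_arc :: "real \<Rightarrow> real \<Rightarrow> real \<Rightarrow> real set" where
  "cw_arc c p q = (if p \<le> q then {p<..<q} else {p<..<c} \<union> {0..<q})"

definition cw_len :: "real \<Rightarrow> real \<Rightarrow> real \<Rightarrow> real" where
  "cw_len c p q = (if p \<le> q then q - p else (c - p) + q)"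

text \<open>An arc is given by its extremes \<open>(s, t)\<close>. An extreme of a model is an arc together with
  a kind, so that extremes of different arcs are different extremes even if they occupy the same
  point of the circle.\<close>

type_synonym arc = "real \<times> real"

datatype kind = S | T

fun ext :: "kind \<Rightarrow> arc \<Rightarrow> real" where
  "ext S A = fst A"
| "ext T A = snd A"

record ca_model =
  circ :: real
  arcs :: "arc set"

definition arc_points :: "ca_model \<Rightarrow> arc \<Rightarrow> real set" where
  "arc_points M A = cw_arc (circ M) (ext S A) (ext T A)"

definition pca_model :: "ca_model \<Rightarrow> bool" where
  "pca_model M \<longleftrightarrow>
     circ M > 0 \<and>
     finite (arcs M) \<and>
     (\<forall>A\<in>arcs M. \<forall>e. ext e A \<in> circle (circ M)) \<and>
     (\<forall>A\<in>arcs M. ext S A \<noteq> ext T A) \<and>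
     (\<forall>A\<in>arcs M. \<forall>B\<in>arcs M. A \<noteq> B \<longrightarrow> \<not> arc_points M A \<subseteq> arc_points M B) \<and>
     (\<forall>A\<in>arcs M. \<forall>B\<in>arcs M. A \<noteq> B \<longrightarrow> arc_points M A \<union> arc_points M B \<noteq> circle (circ M))"

definition extremes :: "ca_model \<Rightarrow> (kind \<times> arc) set" where
  "extremes M = UNIV \<times> arcs M"

definition pos :: "kind \<times> arc \<Rightarrow> real" where
  "pos x = ext (fst x) (snd x)"

definition consecutive :: "ca_model \<Rightarrow> kind \<times> arc \<Rightarrow> kind \<times> arc \<Rightarrow> bool" where
  "consecutive M x y \<longleftrightarrow>
     x \<in> extremes M \<and> y \<in> extremes M \<and> x \<noteq> y \<and>
     (\<forall>z\<in>extremes M. pos z \<notin> cw_arc (circ M) (pos x) (pos y))"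

definition equivalent :: "ca_model \<Rightarrow> ca_model \<Rightarrow> bool" where
  "equivalent M M' \<longleftrightarrow>
     (\<exists>f. bij_betw f (arcs M) (arcs M') \<and>
        (\<forall>A\<in>arcs M. \<forall>B\<in>arcs M. \<forall>e e'. ext e (f A) < ext e' (f B) \<longleftrightarrow> ext e A < ext e' B))"

definition u_ca_model :: "real \<Rightarrow> real \<Rightarrow> real \<Rightarrow> real \<Rightarrow> ca_model \<Rightarrow> bool" where
  "u_ca_model c l d ds M \<longleftrightarrow>
     c > 0 \<and> l > 0 \<and> d > 0 \<and> ds \<ge> 0 \<and>
     pca_model M \<and>
     circ M = c \<and>
     (\<forall>A\<in>arcs M. cw_len c (ext S A) (ext T A) = l) \<and>
     (\<forall>x y. consecutive M x y \<longrightarrow> cw_len c (pos x) (pos y) \<ge> d) \<and>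
     (\<forall>A\<in>arcs M. \<forall>B\<in>arcs M. A \<noteq> B \<longrightarrow> cw_len c (ext S A) (ext S B) \<ge> d + ds)"

definition minimal_ca_model :: "real \<Rightarrow> real \<Rightarrow> real \<Rightarrow> real \<Rightarrow> ca_model \<Rightarrow> bool" where
  "minimal_ca_model c l d ds U \<longleftrightarrow>
     u_ca_model c l d ds U \<and>
     (\<forall>c' l' U'. u_ca_model c' l' d ds U' \<and> equivalent U' U \<longrightarrow> l \<le> l' \<and> c \<le> c')"

end

theory Submission
  imports Defs "HOL-Analysis.Brouwer_Fixpoint"
begin

text \<open>
  Unroll the circle and put the point \<open>(s + j c - r l, r)\<close> in the plane for every start \<open>s\<close> and all
  integers \<open>j\<close>, \<open>r\<close>. The constraints become separation conditions inside a row (distance at least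
  \<open>d + d\<^sub>s\<close>) and between adjacent rows (horizontal distance at least \<open>d\<close>). Join two points by an edge
  when their constraint is tight; drawn with straight segments this graph is planar, and it is
  invariant under the lattice generated by \<open>(c, 0)\<close> and \<open>(- l, 1)\<close>.

  If a nonzero linear form on the lattice vanished on every translation that maps some component to
  itself, it would extend to an infinitesimal motion of the model preserving all tight constraints,
  and following it in one of the two directions would contradict minimality. Hence there are
  components invariant under two independent translations. By planarity and Brouwer's theorem such
  components intersect, also after an arbitrary lattice translation of one of them, so a component
  is invariant under the whole lattice. Along edges the first coordinate changes by \<open>d\<close> or \<open>d + d\<^sub>s\<close> up
  to sign, so \<open>c\<close> and \<open>l\<close> are integer combinations of \<open>d\<close> and \<open>d\<^sub>s\<close>.
\<close>

section \<open>Crossing periodic curves\<close>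

text \<open>The polygonal curve through the points \<open>f i\<close>, one edge per unit of time; it
  turns a walk in the graph into a continuous curve.\<close>

definition interp :: "(int \<Rightarrow> 'a::real_normed_vector) \<Rightarrow> real \<Rightarrow> 'a" where
  "interp f t = f \<lfloor>t\<rfloor> + frac t *\<^sub>R (f (\<lfloor>t\<rfloor> + 1) - f \<lfloor>t\<rfloor>)"

text \<open>The affine formula of a piece also holds at its right end, where the floor has already
  jumped to \<open>i + 1\<close>. Hence closed pieces can be glued in the continuity proof.\<close>

lemma interp_eq:
  assumes "of_int i \<le> t" "t \<le> of_int i + 1"
  shows "interp f t = f i + (t - of_int i) *\<^sub>R (f (i + 1) - f i)"
proof (cases "t = of_int i + 1")
  case True
  then have "t = of_int (i + 1)" by simp
  then have "\<lfloor>t\<rfloor> = i + 1" "frac t = 0" by (simp_all only: floor_of_int frac_of_int)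
  then show ?thesis using True by (simp add: interp_def)
next
  case False
  then have "\<lfloor>t\<rfloor> = i" using assms by linarith
  then show ?thesis by (simp add: interp_def frac_def)
qed

lemma interp_in_closed_segment: "interp f t \<in> closed_segment (f \<lfloor>t\<rfloor>) (f (\<lfloor>t\<rfloor> + 1))"
proof -
  have "0 \<le> frac t" "frac t \<le> 1" using frac_lt_1[of t] by auto
  moreover have "interp f t = (1 - frac t) *\<^sub>R f \<lfloor>t\<rfloor> + frac t *\<^sub>R f (\<lfloor>t\<rfloor> + 1)"
    by (simp add: interp_def algebra_simps)
  ultimately show ?thesis by (auto simp: closed_segment_def)
qed

lemma continuous_on_interp: "continuous_on A (interp f)"
proof -
  have pc: "continuous_on {of_int i..of_int i + 1} (interp f)" for i
    by (rule continuous_on_eq[where f = "\<lambda>t. f i + (t - of_int i) *\<^sub>R (f (i + 1) - f i)"])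
      (auto simp: interp_eq intro!: continuous_intros)
  have "isCont (interp f) t" for t
  proof -
    define j where "j = \<lfloor>t\<rfloor>"
    have "continuous_on ({of_int (j - 1)..of_int (j - 1) + 1} \<union> {of_int j..of_int j + 1}) (interp f)"
      by (intro continuous_on_closed_Un pc) auto
    then have "continuous_on {of_int j - 1<..<of_int j + 1} (interp f)"
      by (rule continuous_on_subset) auto
    moreover have "t \<in> {of_int j - 1<..<of_int j + 1}"
      unfolding j_def using floor_correct[of t] by (auto intro: less_le_trans[of _ "of_int \<lfloor>t\<rfloor>"])
    ultimately show ?thesis
      using continuous_on_eq_continuous_at open_greaterThanLessThan by blast
  qed
  then show ?thesis by (simp add: continuous_at_imp_continuous_on)
qed

lemma periodic_multiple:
  fixes f :: "int \<Rightarrow> 'a::real_vector"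
  assumes "\<And>i. f (i + m) = f i + V"
  shows "f (i + k * m) = f i + of_int k *\<^sub>R V"
proof (induction k rule: int_induct[where k = 0])
  case base
  then show ?case by simp
next
  case (step1 k)
  have "f (i + (k + 1) * m) = f (i + k * m + m)" by (simp add: algebra_simps)
  then show ?case using step1 by (simp only: assms) (simp add: algebra_simps)
next
  case (step2 k)
  have "f (i + k * m) = f (i + (k - 1) * m + m)" by (simp add: algebra_simps)
  then show ?case using step2 by (simp only: assms) (simp add: algebra_simps)
qed

text \<open>Subtracting the uniform motion with the mean velocity \<open>V / m\<close> leaves a
  function of period \<open>m\<close>, whose values are all taken on the compact interval from 0 to
  \<open>m\<close>.\<close>

lemma interp_periodic_bounded:
  fixes f :: "int \<Rightarrow> 'a::real_normed_vector"
  assumes per: "\<And>i. f (i + m) = f i + V" and "m > 0"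
  shows "bounded (range (\<lambda>t. interp f t - t *\<^sub>R (V /\<^sub>R of_int m)))"
proof -
  define g where "g t = interp f t - t *\<^sub>R (V /\<^sub>R of_int m)" for t :: real
  have g_periodic: "g (t + of_int (k * m)) = g t" for t k
  proof -
    have fl: "\<lfloor>t + of_int (k * m)\<rfloor> = \<lfloor>t\<rfloor> + k * m" by (rule floor_add_int[symmetric])
    then have fr: "frac (t + of_int (k * m)) = frac t" by (simp add: frac_def)
    have "f (\<lfloor>t\<rfloor> + k * m + 1) = f (\<lfloor>t\<rfloor> + 1) + of_int k *\<^sub>R V"
      using periodic_multiple[of f m V "\<lfloor>t\<rfloor> + 1" k] per by (simp add: algebra_simps)
    then have "interp f (t + of_int (k * m)) = interp f t + of_int k *\<^sub>R V"
      unfolding interp_def fl fr using periodic_multiple[of f m V "\<lfloor>t\<rfloor>" k] per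
      by (simp add: algebra_simps)
    moreover have "(t + of_int (k * m)) *\<^sub>R (V /\<^sub>R of_int m) = t *\<^sub>R (V /\<^sub>R of_int m) + of_int k *\<^sub>R V"
      using \<open>m > 0\<close> unfolding scaleR_add_left by simp
    ultimately show ?thesis by (simp add: g_def)
  qed
  have "continuous_on {0..of_int m} g"
    unfolding g_def by (intro continuous_intros continuous_on_interp)
  then have "bounded (g ` {0..of_int m})"
    by (intro compact_imp_bounded compact_continuous_image) auto
  moreover have "range g \<subseteq> g ` {0..of_int m}"
  proof clarify
    fix t :: real
    define k where "k = \<lfloor>t / of_int m\<rfloor>"
    have "of_int k \<le> t / of_int m" "t / of_int m \<le> of_int k + 1"
      unfolding k_def using floor_correct[of "t / of_int m"] by auto
    then have "t - of_int (k * m) \<in> {0..of_int m}"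
      using \<open>m > 0\<close> by (auto simp: field_simps)
    moreover have "g t = g (t - of_int (k * m))"
      using g_periodic[of "t - of_int (k * m)" k] by simp
    ultimately show "g t \<in> g ` {0..of_int m}" by blast
  qed
  ultimately show ?thesis unfolding g_def using bounded_subset by blast
qed

text \<open>Cramer's rule turns an intersection of two curves that stay close to non-parallel lines into a
  fixed point of a bounded continuous map.\<close>

lemma curves_near_lines_intersect:
  fixes \<gamma> \<delta> :: "real \<Rightarrow> real \<times> real"
  assumes cont: "continuous_on UNIV \<gamma>" "continuous_on UNIV \<delta>"
    and bd: "bounded (range (\<lambda>t. \<gamma> t - t *\<^sub>R V))" "bounded (range (\<lambda>t. \<delta> t - t *\<^sub>R W))"
    and det: "fst V * snd W - snd V * fst W \<noteq> 0"
  shows "\<exists>s t. \<gamma> s = \<delta> t"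
proof -
  define \<Delta> where "\<Delta> = fst V * snd W - snd V * fst W"
  have "\<Delta> \<noteq> 0" using det by (simp add: \<Delta>_def)
  \<comment> \<open>\<open>e\<close> collects the bounded deviations from the two lines. The
    equation \<open>\<gamma> s = \<delta> t\<close> says that \<open>s V - t W\<close> equals
    \<open>e (s, t)\<close>, and \<open>L\<close> solves this system for \<open>(s, t)\<close>, so
    intersections are the fixed points of \<open>L o e\<close>.\<close>
  define e where "e z = (\<delta> (snd z) - snd z *\<^sub>R W) - (\<gamma> (fst z) - fst z *\<^sub>R V)" for z
  define L where "L w = ((fst w * snd W - snd w * fst W) / \<Delta>, (fst w * snd V - snd w * fst V) / \<Delta>)"
    for w :: "real \<times> real"
  have linL: "bounded_linear L"
    unfolding L_def
    by (intro bounded_linear_intros bounded_linear_Pair bounded_linear_sub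
        bounded_linear_divide[THEN bounded_linear_compose]
        bounded_linear_mult_left[THEN bounded_linear_compose]) 
  obtain B1 B2 where B: "\<And>t. norm (\<gamma> t - t *\<^sub>R V) \<le> B1" "\<And>t. norm (\<delta> t - t *\<^sub>R W) \<le> B2"
    using bd by (auto simp: bounded_iff)
  have "norm (e z) \<le> B2 + B1" for z
    unfolding e_def using norm_triangle_ineq4 B by (meson add_mono order_trans)
  then have "bounded (range e)" by (auto simp: bounded_iff)
  then have "bounded (L ` range e)" using linL by (rule bounded_linear_image)
  then obtain K where K: "\<And>z. norm (L (e z)) \<le> K" by (auto simp: bounded_iff)
  then have "0 \<le> K" using norm_ge_zero order_trans by blast
  have "continuous_on (cball 0 K) (\<lambda>z. L (e z))"
    unfolding e_def
    by (intro bounded_linear.continuous_on[OF linL] continuous_intros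
        continuous_on_compose2[OF cont(1)] continuous_on_compose2[OF cont(2)]) auto
  then have "\<exists>z\<in>cball 0 K. L (e z) = z"
    by (rule brouwer[OF compact_cball convex_cball, rotated]) (use K \<open>0 \<le> K\<close> in auto)
  then obtain z where "L (e z) = z" by blast
  then obtain s t where L: "L (e (s, t)) = (s, t)" by (cases z) auto
  define u v where "u = fst (e (s, t))" and "v = snd (e (s, t))"
  have s: "s * \<Delta> = u * snd W - v * fst W" and t: "t * \<Delta> = u * snd V - v * fst V"
    using L \<open>\<Delta> \<noteq> 0\<close> by (auto simp: L_def u_def v_def field_simps)
  have "(s * fst V - t * fst W) * \<Delta> = u * \<Delta>"
    using s t unfolding \<Delta>_def by algebra
  moreover have "(s * snd V - t * snd W) * \<Delta> = v * \<Delta>"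
    using s t unfolding \<Delta>_def by algebra
  ultimately have "s *\<^sub>R V - t *\<^sub>R W = e (s, t)"
    using \<open>\<Delta> \<noteq> 0\<close> by (simp add: prod_eq_iff u_def v_def)
  then have "\<gamma> s = \<delta> t" by (simp add: e_def algebra_simps)
  then show ?thesis by blast
qed

text \<open>The points carry their row number as second coordinate. Edges join horizontal neighbours, or
  points of adjacent rows at the minimum horizontal distance \<open>d\<close>; drawn as straight segments they
  cross only in vertices.\<close>

definition row_edge :: "(real \<times> real) set \<Rightarrow> real \<Rightarrow> real \<times> real \<Rightarrow> real \<times> real \<Rightarrow> bool" where
  "row_edge P d p q \<longleftrightarrow> p \<in> P \<and> q \<in> P \<and>
     (snd q = snd p \<and> fst p < fst q \<and>
        (\<forall>z\<in>P. snd z = snd p \<longrightarrow> \<not> (fst p < fst z \<and> fst z < fst q))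
      \<or> snd q = snd p + 1 \<and> \<bar>fst q - fst p\<bar> = d)"

text \<open>No vertex lies strictly inside a horizontal edge, and a diagonal edge reaches a row only
  at its ends. Two diagonals between the same rows either are parallel, hence coincide if they meet,
  or have opposite slopes; crossing in the interior would then bring the top of one closer than
  \<open>d\<close> to the bottom of the other.\<close>

lemma row_edges_meet_in_vertex:
  assumes rows: "\<And>z. z \<in> P \<Longrightarrow> snd z \<in> \<int>"
    and sep: "\<And>z w. z \<in> P \<Longrightarrow> w \<in> P \<Longrightarrow> snd w = snd z + 1 \<Longrightarrow> \<bar>fst w - fst z\<bar> \<ge> d"
    and e1: "row_edge P d p p'" and e2: "row_edge P d q q'"
    and x: "x \<in> closed_segment p p'" "x \<in> closed_segment q q'"
  shows "{p, p'} \<inter> {q, q'} \<noteq> {}"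
proof -
  obtain u where u: "0 \<le> u" "u \<le> 1" "x = (1 - u) *\<^sub>R p + u *\<^sub>R p'"
    using x(1) by (auto simp: closed_segment_def)
  obtain v where v: "0 \<le> v" "v \<le> 1" "x = (1 - v) *\<^sub>R q + v *\<^sub>R q'"
    using x(2) by (auto simp: closed_segment_def)
  have X: "fst x = fst p + u * (fst p' - fst p)" "fst x = fst q + v * (fst q' - fst q)"
    and Y: "snd x = snd p + u * (snd p' - snd p)" "snd x = snd q + v * (snd q' - snd q)"
    using arg_cong[OF u(3), of fst] arg_cong[OF u(3), of snd]
      arg_cong[OF v(3), of fst] arg_cong[OF v(3), of snd] by (auto simp: algebra_simps)
  have P: "p \<in> P" "p' \<in> P" "q \<in> P" "q' \<in> P" using e1 e2 by (auto simp: row_edge_def)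
  have "snd q - snd p \<in> \<int>" using rows P by auto
  then obtain k where k: "snd q = snd p + of_int k" by (metis Ints_cases add_diff_cancel_left' add_diff_eq)
  have btw: "a \<le> a + w * (b - a) \<and> a + w * (b - a) \<le> b" if "0 \<le> w" "w \<le> 1" "a < b" for a b w :: real
  proof -
    have "w * (b - a) \<le> 1 * (b - a)" using that by (intro mult_right_mono) auto
    then have "w * (b - a) \<le> b - a" by simp
    moreover have "0 \<le> w * (b - a)" using that by simp
    ultimately show ?thesis by linarith
  qed
  have neighbours: "z = a \<or> z = b"
    if "row_edge P d a b" "snd b = snd a" "z \<in> P" "snd z = snd a" "fst a \<le> fst z" "fst z \<le> fst b" for a b z
    using that by (fastforce simp: row_edge_def prod_eq_iff)
  consider (HH) "snd p' = snd p" "snd q' = snd q" | (HD) "snd p' = snd p" "snd q' = snd q + 1"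
    | (DH) "snd p' = snd p + 1" "snd q' = snd q" | (DD) "snd p' = snd p + 1" "snd q' = snd q + 1"
    using e1 e2 by (auto simp: row_edge_def)
  then show ?thesis
  proof cases
    case HH
    have lt: "fst p < fst p'" "fst q < fst q'" using e1 e2 HH by (auto simp: row_edge_def)
    have "fst p \<le> fst x" "fst x \<le> fst p'" "fst q \<le> fst x" "fst x \<le> fst q'"
      using btw[OF u(1,2) lt(1)] btw[OF v(1,2) lt(2)] X by simp_all
    moreover have "snd p = snd q" using HH Y by simp
    ultimately show ?thesis
      using neighbours[OF e1 HH(1) P(3)] neighbours[OF e2 HH(2) P(1)] by (cases "fst p \<le> fst q") auto
  next
    case HD
    then have "v = of_int (- k)" using Y k by simp
    then have "v = 0 \<or> v = 1" using v(1,2) by (simp add: algebra_simps) linarith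
    then have xq: "x = q \<or> x = q'" using v(3) by auto
    have lt: "fst p < fst p'" using e1 HD by (auto simp: row_edge_def)
    have "x = p \<or> x = p'"
      using neighbours[OF e1 HD(1), of x] btw[OF u(1,2) lt] X Y HD xq P by auto
    then show ?thesis using xq by auto
  next
    case DH
    then have "u = of_int k" using Y k by simp
    then have "u = 0 \<or> u = 1" using u(1,2) by simp linarith
    then have xp: "x = p \<or> x = p'" using u(3) by auto
    have lt: "fst q < fst q'" using e2 DH by (auto simp: row_edge_def)
    have "x = q \<or> x = q'"
      using neighbours[OF e2 DH(2), of x] btw[OF v(1,2) lt] X Y DH xp P by auto
    then show ?thesis using xp by auto
  next
    case DD
    then have uk: "u = of_int k + v" using Y k by simp
    then have "k = 0 \<or> k = 1 \<or> k = - 1" using u(1,2) v(1,2) by linarith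
    \<comment> \<open>For \<open>k = 1\<close> and \<open>k = - 1\<close> the two strips share only
      one row, so the segments meet there, in an end of each.\<close>
    then consider "k = 0" | "u = 1" "v = 0" | "u = 0" "v = 1" using u(1,2) v(1,2) uk by fastforce
    then show ?thesis
    proof cases
      case 1
      have "d \<le> \<bar>fst p' - fst q\<bar>"
        using sep[of q p'] P DD k 1 by auto
      have same: "u = v" "snd p = snd q" "snd p' = snd q'" using uk k 1 DD by auto
      have dd: "\<bar>fst p' - fst p\<bar> = d" "\<bar>fst q' - fst q\<bar> = d" using e1 e2 DD by (auto simp: row_edge_def)
      have "fst p = fst q \<or> fst p' = fst q'"
      proof (cases "fst p' - fst p = fst q' - fst q")
        case True
        then show ?thesis using X same by auto
      next
        case False
        then have "0 < d" and opp: "fst q' - fst q = - (fst p' - fst p)" using dd by auto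
        have "fst p' - fst q = (1 - 2 * u) * (fst p' - fst p)"
          using X opp same by algebra
        then have "d \<le> \<bar>1 - 2 * u\<bar> * d"
          using \<open>d \<le> \<bar>fst p' - fst q\<bar>\<close> dd by (simp add: abs_mult)
        then have "1 \<le> \<bar>1 - 2 * u\<bar>" using \<open>0 < d\<close> by simp
        then have "u = 0 \<or> u = 1" using u(1,2) by linarith
        then show ?thesis using X same by auto
      qed
      then show ?thesis using same by (auto simp: prod_eq_iff)
    next
      case 2
      then show ?thesis using u(3) v(3) by auto
    next
      case 3
      then show ?thesis using u(3) v(3) by auto
    qed
  qed
qed

text \<open>Drawn as polygonal curves, the walks stay near lines with directions \<open>V\<close>
  and \<open>W\<close>, so they cross; the crossing lies on an edge of each, and edges that meet
  have a common end.\<close>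

lemma periodic_walks_share_vertex:
  fixes f g :: "int \<Rightarrow> real \<times> real"
  assumes rows: "\<And>z. z \<in> P \<Longrightarrow> snd z \<in> \<int>"
    and sep: "\<And>z w. z \<in> P \<Longrightarrow> w \<in> P \<Longrightarrow> snd w = snd z + 1 \<Longrightarrow> \<bar>fst w - fst z\<bar> \<ge> d"
    and f: "\<And>i. row_edge P d (f i) (f (i + 1)) \<or> row_edge P d (f (i + 1)) (f i)"
    and g: "\<And>i. row_edge P d (g i) (g (i + 1)) \<or> row_edge P d (g (i + 1)) (g i)"
    and per: "\<And>i. f (i + m) = f i + V" "m > 0" "\<And>i. g (i + n) = g i + W" "n > 0"
    and det: "fst V * snd W - snd V * fst W \<noteq> 0"
  shows "\<exists>i j. f i = g j"
proof -
  have "fst (V /\<^sub>R of_int m) * snd (W /\<^sub>R of_int n) - snd (V /\<^sub>R of_int m) * fst (W /\<^sub>R of_int n)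
      = (fst V * snd W - snd V * fst W) / (of_int m * of_int n)"
    using \<open>m > 0\<close> \<open>n > 0\<close> by (simp add: field_simps)
  then have "fst (V /\<^sub>R of_int m) * snd (W /\<^sub>R of_int n) - snd (V /\<^sub>R of_int m) * fst (W /\<^sub>R of_int n) \<noteq> 0"
    using det \<open>m > 0\<close> \<open>n > 0\<close> by simp
  then obtain s t where st: "interp f s = interp g t"
    using curves_near_lines_intersect[OF continuous_on_interp continuous_on_interp
        interp_periodic_bounded[of f, OF per(1,2)] interp_periodic_bounded[of g, OF per(3,4)]] by blast
  define i j where "i = \<lfloor>s\<rfloor>" and "j = \<lfloor>t\<rfloor>"
  have x: "interp f s \<in> closed_segment (f i) (f (i + 1))" "interp f s \<in> closed_segment (g j) (g (j + 1))"
    using interp_in_closed_segment[of f s] interp_in_closed_segment[of g t] st by (simp_all add: i_def j_def)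
  have meet: "{a, b} \<inter> {a', b'} \<noteq> {}"
    if "row_edge P d a b" "row_edge P d a' b'" "x \<in> closed_segment a b" "x \<in> closed_segment a' b'" for a b a' b' x
    by (rule row_edges_meet_in_vertex[OF _ _ that]) (use rows sep in auto)
  \<comment> \<open>A walk may run along an edge against its orientation in \<open>row_edge\<close>,
    so each segment is needed with both orders of its ends.\<close>
  note x' = x[unfolded closed_segment_commute[of "f i"] closed_segment_commute[of "g j"]]
  have "{f i, f (i + 1)} \<inter> {g j, g (j + 1)} \<noteq> {}"
    using f[of i] g[of j] meet[OF _ _ x] meet[OF _ _ x(1) x'(2)] meet[OF _ _ x'(1) x(2)] meet[OF _ _ x'(1) x'(2)]
    by auto
  then have "f i = g j \<or> f i = g (j + 1) \<or> f (i + 1) = g j \<or> f (i + 1) = g (j + 1)" by auto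
  then show ?thesis by blast
qed

section \<open>The graph of tight constraints\<close>

text \<open>A path from \<open>p\<close> to \<open>p + V\<close> is continued by its translates in
  both directions: \<open>i mod n\<close> gives the place in the path and \<open>i div n\<close> the
  copy.\<close>

lemma periodic_walk_exists:
  fixes V :: "'a::real_vector"
  assumes conn: "R\<^sup>*\<^sup>* p (p + V)" and "V \<noteq> 0"
    and inv: "\<And>a b k. R a b \<Longrightarrow> R (a + of_int k *\<^sub>R V) (b + of_int k *\<^sub>R V)"
  shows "\<exists>F n. n > 0 \<and> F 0 = p \<and> (\<forall>i. F (i + n) = F i + V) \<and> (\<forall>i::int. R (F i) (F (i + 1)))"
proof -
  obtain m f where f: "f 0 = p" "f m = p + V" "\<And>i. i < m \<Longrightarrow> R (f i) (f (Suc i))"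
    using conn unfolding rtranclp_power relpowp_fun_conv by blast
  have "m > 0" using f(1,2) \<open>V \<noteq> 0\<close> by (cases m) auto
  define n where "n = int m"
  have "n > 0" using \<open>m > 0\<close> by (simp add: n_def)
  define F where "F i = f (nat (i mod n)) + of_int (i div n) *\<^sub>R V" for i
  have "F (i + n) = F i + V" for i
    using \<open>n > 0\<close> by (simp add: F_def algebra_simps)
  moreover have "R (F i) (F (i + 1))" for i
  proof -
    have bnd: "0 \<le> i mod n" "i mod n < n" using \<open>n > 0\<close> by auto
    have "R (f (nat (i mod n))) (f (Suc (nat (i mod n))))"
      using bnd by (intro f(3)) (auto simp: n_def)
    then have step: "R (F i) (f (nat (i mod n + 1)) + of_int (i div n) *\<^sub>R V)"
      using inv bnd by (simp add: F_def nat_add_distrib)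
    show ?thesis
    proof (cases "i mod n + 1 = n")
      \<comment> \<open>At the seam the last point \<open>p + V\<close> of one copy is the first
        point of the next.\<close>
      case True
      then have i1: "i + 1 = n * (i div n + 1) + 0"
        using mult_div_mod_eq[of n i] by (simp only: distrib_left)
      have "(i + 1) div n = i div n + 1" "(i + 1) mod n = 0"
        using int_div_pos_eq[OF i1] int_mod_pos_eq[OF i1] \<open>n > 0\<close> by simp_all
      then show ?thesis using step True f(1,2) by (simp add: F_def n_def algebra_simps)
    next
      case False
      have i1: "i + 1 = n * (i div n) + (i mod n + 1)"
        using mult_div_mod_eq[of n i] by simp
      have "(i + 1) div n = i div n" "(i + 1) mod n = i mod n + 1"
        using int_div_pos_eq[OF i1] int_mod_pos_eq[OF i1] bnd False by simp_all
      then show ?thesis using step by (simp add: F_def)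
    qed
  qed
  moreover have "F 0 = p" by (simp add: F_def f)
  ultimately show ?thesis using \<open>n > 0\<close> by blast
qed

lemma rtranclp_walk:
  assumes "symp R" and walk: "\<And>i::int. R (F i) (F (i + 1))"
  shows "R\<^sup>*\<^sup>* (F 0) (F i)"
proof (induction i rule: int_induct[where k = 0])
  case base
  then show ?case by simp
next
  case (step1 i)
  then show ?case using walk[of i] by (rule_tac rtranclp.rtrancl_into_rtrancl)
next
  case (step2 i)
  have "R (F i) (F (i - 1))" using walk[of "i - 1"] \<open>symp R\<close> by (simp add: sympD)
  then show ?case using step2 by (rule_tac rtranclp.rtrancl_into_rtrancl)
qed

text \<open>The two components contain bi-infinite walks with periods \<open>V\<close> and
  \<open>W\<close>. Since these directions are not parallel, the walks share a vertex and the
  components coincide.\<close>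

lemma periodic_components_connected:
  assumes rows: "\<And>z. z \<in> P \<Longrightarrow> snd z \<in> \<int>"
    and sep: "\<And>z w. z \<in> P \<Longrightarrow> w \<in> P \<Longrightarrow> snd w = snd z + 1 \<Longrightarrow> \<bar>fst w - fst z\<bar> \<ge> d"
    and edge: "\<And>a b. R a b \<Longrightarrow> row_edge P d a b \<or> row_edge P d b a"
    and "symp R"
    and inv: "\<And>a b k. R a b \<Longrightarrow> R (a + of_int k *\<^sub>R V) (b + of_int k *\<^sub>R V)"
      "\<And>a b k. R a b \<Longrightarrow> R (a + of_int k *\<^sub>R W) (b + of_int k *\<^sub>R W)"
    and conn: "R\<^sup>*\<^sup>* p (p + V)" "R\<^sup>*\<^sup>* q (q + W)"
    and det: "fst V * snd W - snd V * fst W \<noteq> 0"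
  shows "R\<^sup>*\<^sup>* p q"
proof -
  have nz: "V \<noteq> 0" "W \<noteq> 0" using det by auto
  have "\<exists>F n. n > 0 \<and> F 0 = p \<and> (\<forall>i. F (i + n) = F i + V) \<and> (\<forall>i::int. R (F i) (F (i + 1)))"
    by (rule periodic_walk_exists[OF conn(1) nz(1)]) (rule inv(1))
  then obtain F and n :: int
    where F: "n > 0" "F 0 = p" "\<And>i. F (i + n) = F i + V" "\<And>i. R (F i) (F (i + 1))"
    by blast
  have "\<exists>H m. m > 0 \<and> H 0 = q \<and> (\<forall>i. H (i + m) = H i + W) \<and> (\<forall>i::int. R (H i) (H (i + 1)))"
    by (rule periodic_walk_exists[OF conn(2) nz(2)]) (rule inv(2))
  then obtain H and m :: int
    where H: "m > 0" "H 0 = q" "\<And>i. H (i + m) = H i + W" "\<And>i. R (H i) (H (i + 1))"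
    by blast
  have "\<exists>i j. F i = H j"
    by (rule periodic_walks_share_vertex[where P = P and d = d])
      (fact rows sep edge[OF F(4)] edge[OF H(4)] F(1,3) H(1,3) det)+
  then obtain i j where "F i = H j" by blast
  moreover have "R\<^sup>*\<^sup>* p (F i)" "R\<^sup>*\<^sup>* q (H j)"
    using rtranclp_walk[OF \<open>symp R\<close>] F(2,4) H(2,4) by metis+
  ultimately show ?thesis
    using \<open>symp R\<close> by (metis rtranclp_trans symp_rtranclp sympD)
qed

section \<open>Translations of the graph of tight constraints\<close>

text \<open>The separation conditions on the unrolled circle: \<open>gap\<close> between different
  starts, \<open>sep\<close> between the end \<open>s + l\<close> and every start, including
  \<open>s' = s\<close>. Distances between two ends equal distances between starts, since all arcs
  have length \<open>l\<close>.\<close>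

locale periodic_starts =
  fixes X :: "real set" and c l d ds :: real
  assumes c_pos: "c > 0"
    and gap: "\<And>s s' j. s \<in> X \<Longrightarrow> s' \<in> X \<Longrightarrow> s \<noteq> s' \<Longrightarrow> \<bar>s' + of_int j * c - s\<bar> \<ge> d + ds"
    and sep: "\<And>s s' j. s \<in> X \<Longrightarrow> s' \<in> X \<Longrightarrow> \<bar>s' + of_int j * c - l - s\<bar> \<ge> d"
    and width_pos: "d + ds > 0"
begin

text \<open>Row \<open>r\<close> is moved back by \<open>r * l\<close>, so that the horizontal
  offset between adjacent rows is the offset between a start and an end.\<close>

definition shift :: "int \<Rightarrow> int \<Rightarrow> real \<times> real" where
  "shift j r = (of_int j * c - of_int r * l, of_int r)"

definition points :: "(real \<times> real) set" where
  "points = {(s, 0) + shift j r | s j r. s \<in> X}"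

text \<open>Edges inside a row require \<open>s \<noteq> s'\<close>: for a single arc, \<open>c = d + ds\<close> is not a tight constraint.\<close>

definition tight :: "real \<times> real \<Rightarrow> real \<times> real \<Rightarrow> bool" where
  "tight p q \<longleftrightarrow> (\<exists>s\<in>X. \<exists>s'\<in>X. \<exists>j r j' r'. p = (s, 0) + shift j r \<and> q = (s', 0) + shift j' r' \<and>
     (r' = r \<and> s \<noteq> s' \<and> fst q - fst p = d + ds \<or> r' = r + 1 \<and> \<bar>fst q - fst p\<bar> = d))"

definition adj :: "real \<times> real \<Rightarrow> real \<times> real \<Rightarrow> bool" where
  "adj p q \<longleftrightarrow> tight p q \<or> tight q p"

abbreviation conn :: "real \<times> real \<Rightarrow> real \<times> real \<Rightarrow> bool" where
  "conn \<equiv> adj\<^sup>*\<^sup>*"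

lemma shift_add: "shift j r + shift j' r' = shift (j + j') (r + r')"
  by (simp add: shift_def algebra_simps)

lemma shift_0: "shift 0 0 = 0"
  by (simp add: shift_def zero_prod_def)

lemma shift_scale: "of_int k *\<^sub>R shift j r = shift (k * j) (k * r)"
  by (simp add: shift_def algebra_simps)

lemma symp_adj: "symp adj"
  by (auto simp: symp_def adj_def)

lemma conn_sym: "conn p q \<Longrightarrow> conn q p"
  using symp_adj by (metis symp_rtranclp sympD)

lemma tight_shift:
  assumes "tight p q"
  shows "tight (p + shift j r) (q + shift j r)"
proof -
  obtain s s' i k i' k' where *: "s \<in> X" "s' \<in> X" "p = (s, 0) + shift i k" "q = (s', 0) + shift i' k'"
    "k' = k \<and> s \<noteq> s' \<and> fst q - fst p = d + ds \<or> k' = k + 1 \<and> \<bar>fst q - fst p\<bar> = d"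
    using assms unfolding tight_def by blast
  show ?thesis
    unfolding tight_def
    by (rule bexI[OF _ \<open>s \<in> X\<close>], rule bexI[OF _ \<open>s' \<in> X\<close>],
        rule exI[of _ "i + j"], rule exI[of _ "k + r"], rule exI[of _ "i' + j"], rule exI[of _ "k' + r"])
      (use * in \<open>simp add: shift_def algebra_simps\<close>)
qed

lemma adj_shift: "adj p q \<Longrightarrow> adj (p + shift j r) (q + shift j r)"
  unfolding adj_def using tight_shift by blast

lemma conn_shift: "conn p q \<Longrightarrow> conn (p + shift j r) (q + shift j r)"
  by (induction rule: rtranclp_induct) (auto intro: adj_shift rtranclp.rtrancl_into_rtrancl)

lemma conn_shift_iff: "conn (p + shift j r) (q + shift j r) \<longleftrightarrow> conn p q"
  using conn_shift[of "p + shift j r" "q + shift j r" "- j" "- r"] conn_shift[of p q j r]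
  by (auto simp: add.assoc shift_add shift_0)

lemma points_separated:
  assumes "z \<in> points" "w \<in> points" "snd w = snd z + 1"
  shows "\<bar>fst w - fst z\<bar> \<ge> d"
proof -
  obtain s j r s' j' r' where *: "s \<in> X" "s' \<in> X" "z = (s, 0) + shift j r" "w = (s', 0) + shift j' r'"
    using assms(1,2) unfolding points_def by blast
  have "of_int r' = (of_int r :: real) + 1" using assms(3) * by (simp add: shift_def)
  then have "fst w - fst z = s' + of_int (j' - j) * c - l - s"
    using * by (simp add: shift_def algebra_simps)
  then show ?thesis using sep[OF *(1,2), of "j' - j"] by simp
qed

lemma tight_row_edge:
  assumes "tight p q"
  shows "row_edge points d p q"
proof -
  obtain s s' i k i' k' where *: "s \<in> X" "s' \<in> X" "p = (s, 0) + shift i k" "q = (s', 0) + shift i' k'"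
    "k' = k \<and> s \<noteq> s' \<and> fst q - fst p = d + ds \<or> k' = k + 1 \<and> \<bar>fst q - fst p\<bar> = d"
    using assms unfolding tight_def by blast
  have P: "p \<in> points" "q \<in> points" using * unfolding points_def by blast+
  show ?thesis using *(5)
  proof (elim disjE conjE)
    assume h: "k' = k" "s \<noteq> s'" "fst q - fst p = d + ds"
    have "\<not> (fst p < fst z \<and> fst z < fst q)" if z: "z \<in> points" "snd z = snd p" for z
    proof
      assume btw: "fst p < fst z \<and> fst z < fst q"
      obtain t j r where t: "t \<in> X" "z = (t, 0) + shift j r" using z(1) unfolding points_def by blast
      have "r = k" using z(2) t * by (simp add: shift_def)
      have zp: "fst z - fst p = t + of_int (j - i) * c - s" "fst q - fst z = s' + of_int (i' - j) * c - t"
        using t * h(1) \<open>r = k\<close> by (simp_all add: shift_def algebra_simps)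
      \<comment> \<open>Since \<open>s\<close> and \<open>s'\<close> differ, \<open>t\<close>
        differs from one of them, and the distance \<open>d + ds\<close> forced there leaves no room
        strictly between \<open>p\<close> and \<open>q\<close>.\<close>
      show False
        using gap[OF *(1) t(1), of "j - i"] gap[OF t(1) *(2), of "i' - j"] zp h(2,3) btw by linarith
    qed
    then show ?thesis using P h * width_pos by (auto simp: row_edge_def shift_def)
  next
    assume "k' = k + 1" "\<bar>fst q - fst p\<bar> = d"
    then show ?thesis using P * by (auto simp: row_edge_def shift_def)
  qed
qed

lemma conn_fst_diff:
  assumes "conn p q"
  shows "\<exists>a b :: int. fst q - fst p = of_int a * d + of_int b * ds"
  using assms
proof (induction rule: rtranclp_induct)
  case base
  have "fst p - fst p = of_int 0 * d + of_int 0 * ds" by simp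
  then show ?case by blast
next
  case (step y z)
  then obtain a b :: int where ab: "fst y - fst p = of_int a * d + of_int b * ds" by blast
  have "fst z - fst y \<in> {d + ds, - (d + ds), d, - d}"
    using step(2) by (auto simp: adj_def tight_def)
  then have "\<exists>a' b' :: int. fst z - fst y = of_int a' * d + of_int b' * ds"
  proof (elim insertE emptyE)
    assume "fst z - fst y = d + ds"
    then show ?thesis by (intro exI[of _ 1]) simp
  next
    assume "fst z - fst y = - (d + ds)"
    then show ?thesis by (intro exI[of _ "- 1"]) simp
  next
    assume "fst z - fst y = d"
    then show ?thesis by (intro exI[of _ 1] exI[of _ 0]) simp
  next
    assume "fst z - fst y = - d"
    then show ?thesis by (intro exI[of _ "- 1"] exI[of _ 0]) simp
  qed
  then obtain a' b' :: int where "fst z - fst y = of_int a' * d + of_int b' * ds" by blast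
  then have "fst z - fst p = of_int (a + a') * d + of_int (b + b') * ds"
    using ab by (simp add: algebra_simps)
  then show ?case by blast
qed

text \<open>\<open>\<phi>\<close>, \<open>\<kappa>\<close> and \<open>\<mu>\<close> are the velocities of the starts, of \<open>c\<close> and of \<open>l\<close>.\<close>

definition infinitesimal :: "(real \<Rightarrow> real) \<Rightarrow> real \<Rightarrow> real \<Rightarrow> bool" where
  "infinitesimal \<phi> \<kappa> \<mu> \<longleftrightarrow>
     (\<forall>s\<in>X. \<forall>s'\<in>X. \<forall>j::int. s \<noteq> s' \<longrightarrow> s' + of_int j * c - s = d + ds \<longrightarrow> \<phi> s' + of_int j * \<kappa> = \<phi> s) \<and>
     (\<forall>s\<in>X. \<forall>s'\<in>X. \<forall>j::int. \<bar>s' + of_int j * c - l - s\<bar> = d \<longrightarrow> \<phi> s' + of_int j * \<kappa> - \<mu> = \<phi> s)"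

section \<open>Infinitesimal motions and rigidity\<close>

text \<open>Every component moves rigidly. One start per class of components modulo translations is
  kept at rest, and the others get the velocity that the linear form dictates; this is consistent
  because the form vanishes on translations that map a component to itself.\<close>

lemma infinitesimal_exists:
  assumes h: "\<And>s j r. s \<in> X \<Longrightarrow> conn (s, 0) ((s, 0) + shift j r) \<Longrightarrow> of_int j * \<kappa> - of_int r * \<mu> = 0"
  shows "\<exists>\<phi>. infinitesimal \<phi> \<kappa> \<mu>"
proof -
  define rel where "rel s t \<longleftrightarrow> t \<in> X \<and> (\<exists>j r. conn (s, 0) ((t, 0) + shift j r))" for s t
  define rep where "rep s = (SOME t. rel s t)" for s
  have rel_refl: "rel s s" if "s \<in> X" for s
    unfolding rel_def using that by (metis add.right_neutral rtranclp.rtrancl_refl shift_0)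
  have rel_rep: "rel s (rep s)" if "s \<in> X" for s
    unfolding rep_def using rel_refl[OF that] by (rule someI)
  then obtain J K where JK: "\<And>s. s \<in> X \<Longrightarrow> conn (s, 0) ((rep s, 0) + shift (J s) (K s))"
    unfolding rel_def by metis
  \<comment> \<open>With \<open>rep s\<close> at rest, its translate in the component of
    \<open>s\<close> moves at this velocity, and \<open>s\<close> has to move along with it.\<close>
  define \<phi> where "\<phi> s = of_int (J s) * \<kappa> - of_int (K s) * \<mu>" for s
  have key: "\<phi> s' + of_int j * \<kappa> - of_int r * \<mu> = \<phi> s"
    if s: "s \<in> X" "s' \<in> X" and adj: "conn (s, 0) ((s', 0) + shift j r)" for s s' j r
  proof -
    \<comment> \<open>\<open>rep\<close> is a choice from the predicate \<open>rel s\<close>, so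
      agreement of the predicates makes the representatives equal.\<close>
    have "rel s t = rel s' t" for t
    proof
      assume "rel s t"
      then obtain i k where "t \<in> X" "conn (s, 0) ((t, 0) + shift i k)" unfolding rel_def by blast
      then have "conn ((s', 0) + shift j r) ((t, 0) + shift i k)"
        using adj conn_sym rtranclp_trans by metis
      then have "conn (s', 0) ((t, 0) + shift (i - j) (k - r))"
        using conn_shift_iff[of "(s', 0)" j r "(t, 0) + shift (i - j) (k - r)"] by (simp add: add.assoc shift_add)
      then show "rel s' t" using \<open>t \<in> X\<close> unfolding rel_def by blast
    next
      assume "rel s' t"
      then obtain i k where "t \<in> X" "conn (s', 0) ((t, 0) + shift i k)" unfolding rel_def by blast
      then have "conn ((s', 0) + shift j r) ((t, 0) + shift (i + j) (k + r))"
        using conn_shift[of "(s', 0)" _ j r] by (fastforce simp: add.assoc shift_add)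
      then show "rel s t" using \<open>t \<in> X\<close> adj unfolding rel_def by (meson rtranclp_trans)
    qed
    then have rep_eq: "rep s = rep s'" by (simp add: rep_def)
    define t where "t = rep s"
    have t: "t \<in> X" using rel_rep[OF s(1)] by (simp add: t_def rel_def)
    have 1: "conn (s, 0) ((t, 0) + shift (J s) (K s))" using JK[OF s(1)] by (simp add: t_def)
    have "conn ((s', 0) + shift j r) ((t, 0) + shift (J s') (K s') + shift j r)"
      using JK[OF s(2)] conn_shift by (simp add: t_def rep_eq)
    then have 2: "conn (s, 0) ((t, 0) + shift (J s' + j) (K s' + r))"
      using adj by (simp add: add.assoc shift_add)
    \<comment> \<open>Two translates of \<open>t\<close> in one component differ by a translation
      that maps a component to itself, which is where \<open>h\<close> applies.\<close>
    have "conn ((t, 0) + shift (J s) (K s)) ((t, 0) + shift (J s' + j) (K s' + r))"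
      using conn_sym[OF 1] 2 by (rule rtranclp_trans)
    then have "conn (t, 0) ((t, 0) + shift (J s' + j - J s) (K s' + r - K s))"
      using conn_shift_iff[of "(t, 0)" "J s" "K s" "(t, 0) + shift (J s' + j - J s) (K s' + r - K s)"]
      by (simp add: add.assoc shift_add)
    then show ?thesis using h[OF t] by (fastforce simp: \<phi>_def algebra_simps)
  qed
  have "infinitesimal \<phi> \<kappa> \<mu>"
    unfolding infinitesimal_def
  proof (intro conjI ballI allI impI)
    fix s s' and j :: int
    assume s: "s \<in> X" "s' \<in> X" "s \<noteq> s'" "s' + of_int j * c - s = d + ds"
    have "tight ((s, 0) + shift 0 0) ((s', 0) + shift j 0)"
      unfolding tight_def
      by (rule bexI[OF _ s(1)], rule bexI[OF _ s(2)], rule exI[of _ 0], rule exI[of _ 0],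
          rule exI[of _ j], rule exI[of _ 0]) (use s in \<open>simp add: shift_def\<close>)
    then have "adj (s, 0) ((s', 0) + shift j 0)" by (simp add: adj_def shift_0)
    then show "\<phi> s' + of_int j * \<kappa> = \<phi> s" using key[OF s(1,2), of j 0] by auto
  next
    fix s s' and j :: int
    assume s: "s \<in> X" "s' \<in> X" "\<bar>s' + of_int j * c - l - s\<bar> = d"
    have "tight ((s, 0) + shift 0 0) ((s', 0) + shift j 1)"
      unfolding tight_def
      by (rule bexI[OF _ s(1)], rule bexI[OF _ s(2)], rule exI[of _ 0], rule exI[of _ 0],
          rule exI[of _ j], rule exI[of _ 1]) (use s in \<open>simp add: shift_def algebra_simps\<close>)
    then have "adj (s, 0) ((s', 0) + shift j 1)" by (simp add: adj_def shift_0)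
    then show "\<phi> s' + of_int j * \<kappa> - \<mu> = \<phi> s" using key[OF s(1,2), of j 1] by auto
  qed
  then show ?thesis by blast
qed

lemma rigid_imp_integer_combination:
  assumes rigid: "\<And>\<phi> \<kappa> \<mu>. infinitesimal \<phi> \<kappa> \<mu> \<Longrightarrow> \<kappa> = 0 \<and> \<mu> = 0"
  shows "\<exists>a b a' b' :: int. l = of_int a * d + of_int b * ds \<and> c = of_int a' * d + of_int b' * ds"
proof -
  have ex: "\<exists>s\<in>X. \<exists>j r. conn (s, 0) ((s, 0) + shift j r) \<and> of_int j * \<kappa> - of_int r * \<mu> \<noteq> 0"
    if "\<kappa> \<noteq> 0 \<or> \<mu> \<noteq> 0" for \<kappa> \<mu> :: real
    using infinitesimal_exists[of \<kappa> \<mu>] rigid that by blast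
  \<comment> \<open>The form with \<open>\<kappa> = 1\<close> and \<open>\<mu> = 0\<close> reads off
    \<open>j\<close>, so some component has a period with nonzero \<open>j\<close>.\<close>
  obtain s j r where s: "s \<in> X" "conn (s, 0) ((s, 0) + shift j r)" "of_int j \<noteq> (0::real)"
    using ex[of 1 0] by auto
  \<comment> \<open>The form with \<open>\<kappa> = r\<close> and \<open>\<mu> = j\<close> vanishes
    on the first period; a period on which it does not vanish is therefore independent of the
    first.\<close>
  obtain t i k where t: "t \<in> X" "conn (t, 0) ((t, 0) + shift i k)" "of_int i * of_int r - of_int k * of_int j \<noteq> (0::real)"
    using ex[of "of_int r" "of_int j"] s(3) by auto
  have det: "fst (shift j r) * snd (shift i k) - snd (shift j r) * fst (shift i k) \<noteq> 0"
  proof -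
    have "fst (shift j r) * snd (shift i k) - snd (shift j r) * fst (shift i k)
        = - c * (of_int i * of_int r - of_int k * of_int j)"
      by (simp add: shift_def algebra_simps)
    then show ?thesis using t(3) c_pos by simp
  qed
  \<comment> \<open>Each translate of the component of \<open>s\<close> keeps the period
    \<open>shift j r\<close>, so it meets the component of \<open>t\<close>; hence all translates of
    \<open>(s, 0)\<close> lie in one component.\<close>
  have to_t: "conn ((s, 0) + shift a b) (t, 0)" for a b
  proof (rule periodic_components_connected[where P = points and d = d, OF _ _ _ symp_adj _ _ _ t(2) det])
    show "conn ((s, 0) + shift a b) ((s, 0) + shift a b + shift j r)"
      using conn_shift[OF s(2), of a b] by (simp add: add_ac)
    show "row_edge points d p q \<or> row_edge points d q p" if "adj p q" for p q
      using that tight_row_edge unfolding adj_def by blast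
    show "snd z \<in> \<int>" if "z \<in> points" for z
      using that by (auto simp: points_def shift_def)
  qed (simp_all only: shift_scale adj_shift points_separated)
  have "conn (s, 0) ((s, 0) + shift a b)" for a b
    using to_t[of 0 0] conn_sym[OF to_t[of a b]] by (auto simp: shift_0 intro: rtranclp_trans)
  then have G: "\<exists>a' b' :: int. fst (shift a b) = of_int a' * d + of_int b' * ds" for a b
    using conn_fst_diff[of "(s, 0)" "(s, 0) + shift a b"] by fastforce
  show ?thesis
    \<comment> \<open>\<open>shift 0 (- 1)\<close> moves the first coordinate by \<open>l\<close>,
      and \<open>shift 1 0\<close> moves it by \<open>c\<close>.\<close>
    using G[of 0 "- 1"] G[of 1 0] by (auto simp: shift_def)
qed

end

section \<open>Deformation of models\<close>

lemma finite_extremes: "pca_model M \<Longrightarrow> finite (extremes M)"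
proof -
  have "(UNIV :: kind set) = {S, T}" using kind.exhaust by auto
  then have "finite (UNIV :: kind set)" by (metis finite.emptyI finite_insert)
  then show "pca_model M \<Longrightarrow> finite (extremes M)" by (simp add: extremes_def pca_model_def)
qed

lemma pos_in_circle:
  assumes "pca_model M" "x \<in> extremes M"
  shows "pos x \<in> circle (circ M)"
  using assms by (auto simp: pca_model_def extremes_def pos_def)

lemma cw_len_less_if_in_arc:
  assumes "p \<in> circle c" "q \<in> circle c" "w \<in> cw_arc c p q"
  shows "cw_len c p w < cw_len c p q"
  using assms by (auto simp: circle_def cw_arc_def cw_len_def split: if_splits)

text \<open>The lifts of \<open>q\<close> next to \<open>p\<close> lie \<open>cw_len c p q\<close>
  ahead of it and \<open>cw_len c q p\<close> behind it; all other lifts are farther away.\<close>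

lemma abs_lift_diff_ge:
  assumes "p \<in> circle c" "q \<in> circle c" "cw_len c p q \<ge> D" "cw_len c q p \<ge> D"
  shows "\<bar>q - p + of_int j * c\<bar> \<ge> D"
proof -
  have c: "c > 0" using assms(1) by (auto simp: circle_def)
  define w where "w = of_int j * c"
  consider "j = 0" | "j \<ge> 1" | "j \<le> - 1" by linarith
  then have "w = 0 \<or> w \<ge> c \<or> w \<le> - c"
  proof cases
    case 2
    then have "of_int j * c \<ge> 1 * c" using c by (intro mult_right_mono) auto
    then show ?thesis by (simp add: w_def)
  next
    case 3
    then have "of_int j \<le> (- 1 :: real)" by linarith
    then have "of_int j * c \<le> - 1 * c" using c by (intro mult_right_mono) auto
    then show ?thesis by (simp add: w_def)
  qed (simp add: w_def)
  then have "\<bar>q - p + w\<bar> \<ge> D"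
    using assms unfolding circle_def cw_len_def by (auto split: if_splits)
  then show ?thesis by (simp add: w_def)
qed

text \<open>The definition bounds only consecutive pairs. The extreme nearest to \<open>x\<close>
  clockwise is consecutive to \<open>x\<close>, and all others are at least as far.\<close>

lemma u_ca_model_separated:
  assumes u: "u_ca_model c l d ds M" and x: "x \<in> extremes M" and y: "y \<in> extremes M" and "x \<noteq> y"
  shows "cw_len c (pos x) (pos y) \<ge> d"
proof -
  have pca: "pca_model M" and c: "circ M = c" using u by (auto simp: u_ca_model_def)
  let ?E = "extremes M - {x}"
  have "finite ?E" "?E \<noteq> {}" using finite_extremes[OF pca] y \<open>x \<noteq> y\<close> by auto
  then obtain z where z: "z \<in> ?E" "\<And>w. w \<in> ?E \<Longrightarrow> cw_len c (pos x) (pos z) \<le> cw_len c (pos x) (pos w)"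
    using ex_is_arg_min_if_finite[of ?E "\<lambda>w. cw_len c (pos x) (pos w)"]
    unfolding is_arg_min_linorder by blast
  have "pos w \<notin> cw_arc c (pos x) (pos z)" if w: "w \<in> extremes M" for w
  proof (cases "w = x")
    case True
    then show ?thesis by (auto simp: cw_arc_def)
  next
    case False
    then show ?thesis
      using z w cw_len_less_if_in_arc pos_in_circle[OF pca] x c by (metis DiffD1 DiffI leD singletonD)
  qed
  then have "consecutive M x z" using z(1) x c by (auto simp: consecutive_def)
  then have "d \<le> cw_len c (pos x) (pos z)" using u unfolding u_ca_model_def by blast
  then show ?thesis using z(2)[of y] y \<open>x \<noteq> y\<close> by auto
qed

section \<open>Inclusions and covers in terms of the order of extremes\<close>

text \<open>The right side compares extremes only and does not mention \<open>c\<close>, so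
  inclusion is determined by their order from \<open>0\<close>.\<close>

lemma cw_arc_subset_iff:
  assumes "p \<in> circle c" "q \<in> circle c" "p' \<in> circle c" "q' \<in> circle c" "p \<noteq> q" "p' \<noteq> q'"
  shows "cw_arc c p q \<subseteq> cw_arc c p' q' \<longleftrightarrow>
    (if p < q then if p' < q' then p' \<le> p \<and> q \<le> q' else p' \<le> p \<or> q \<le> q'
     else q' < p' \<and> p' \<le> p \<and> q \<le> q')"
proof -
  consider "p < q" "p' < q'" | "p < q" "q' < p'" | "q < p" "p' < q'" | "q < p" "q' < p'"
    using assms(5,6) by linarith
  then show ?thesis
  proof cases
    case 1
    then show ?thesis by (auto simp: cw_arc_def greaterThanLessThan_subseteq_greaterThanLessThan)
  next
    case 2
    have "p' \<le> p \<or> q \<le> q'" if "cw_arc c p q \<subseteq> cw_arc c p' q'"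
    proof (rule ccontr)
      assume neg: "\<not> (p' \<le> p \<or> q \<le> q')"
      then obtain z where "max p q' < z" "z < min q p'"
        using dense[of "max p q'" "min q p'"] 2 by auto
      then show False using that 2 by (auto simp: cw_arc_def subset_iff)
    qed
    then show ?thesis using 2 assms by (auto simp: cw_arc_def circle_def)
  next
    case 3
    have "\<not> cw_arc c p q \<subseteq> cw_arc c p' q'"
    proof
      assume sub: "cw_arc c p q \<subseteq> cw_arc c p' q'"
      \<comment> \<open>Points just before \<open>c\<close> belong to an arc whose end precedes its
        start, but not to one whose start comes first.\<close>
      obtain z where "max p q' < z" "z < c"
        using dense[of "max p q'" c] assms by (auto simp: circle_def)
      then show False using sub 3 by (auto simp: cw_arc_def subset_iff)
    qed
    then show ?thesis using 3 by simp
  next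
    case 4
    have "p' \<le> p \<and> q \<le> q'" if sub: "cw_arc c p q \<subseteq> cw_arc c p' q'"
    proof (rule ccontr)
      assume "\<not> (p' \<le> p \<and> q \<le> q')"
      then consider "p < p'" | "q' < q" by linarith
      then show False
      proof cases
        case 1
        then obtain z where "max p q' < z" "z < p'" using dense[of "max p q'" p'] 4 by auto
        then show False using sub 4 assms by (fastforce simp: cw_arc_def subset_iff circle_def)
      next
        case 2
        then obtain z where "q' < z" "z < min q p'" using dense[of q' "min q p'"] 4 by auto
        then show False using sub 4 assms by (fastforce simp: cw_arc_def subset_iff circle_def)
      qed
    qed
    then show ?thesis using 4 assms by (auto simp: cw_arc_def circle_def)
  qed
qed

text \<open>Again an order condition. Open arcs omit their own extremes, so in a cover the extremes
  of one arc lie in the other; two arcs that do not pass \<open>0\<close> both miss the point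
  \<open>0\<close>.\<close>

lemma cw_arcs_cover_iff:
  assumes "p \<in> circle c" "q \<in> circle c" "p' \<in> circle c" "q' \<in> circle c" "p \<noteq> q" "p' \<noteq> q'"
  shows "cw_arc c p q \<union> cw_arc c p' q' = circle c \<longleftrightarrow>
    (if p < q then q' < p' \<and> p < q' \<and> p' < q
     else if p' < q' then p' < q \<and> p < q' else p < q' \<or> p' < q)"
proof -
  consider "p < q" "p' < q'" | "p < q" "q' < p'" | "q < p" "p' < q'" | "q < p" "q' < p'"
    using assms(5,6) by linarith
  then show ?thesis
  proof cases
    case 1
    then have "0 \<in> circle c" "0 \<notin> cw_arc c p q \<union> cw_arc c p' q'"
      using assms by (auto simp: cw_arc_def circle_def)
    then show ?thesis using 1 by auto
  next
    case 2
    have "p < q' \<and> p' < q" if "cw_arc c p q \<union> cw_arc c p' q' = circle c"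
    proof -
      have "q' \<in> cw_arc c p q \<union> cw_arc c p' q'" "p' \<in> cw_arc c p q \<union> cw_arc c p' q'"
        using that assms by auto
      then show ?thesis using 2 by (auto simp: cw_arc_def split: if_splits)
    qed
    then show ?thesis using 2 assms by (auto simp: cw_arc_def circle_def)
  next
    case 3
    have "p < q' \<and> p' < q" if "cw_arc c p q \<union> cw_arc c p' q' = circle c"
    proof -
      have "q \<in> cw_arc c p q \<union> cw_arc c p' q'" "p \<in> cw_arc c p q \<union> cw_arc c p' q'"
        using that assms by auto
      then show ?thesis using 3 by (auto simp: cw_arc_def split: if_splits)
    qed
    then show ?thesis using 3 assms by (auto simp: cw_arc_def circle_def)
  next
    case 4
    have "p < q' \<or> p' < q" if "cw_arc c p q \<union> cw_arc c p' q' = circle c"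
    proof -
      have "p \<in> cw_arc c p q \<union> cw_arc c p' q'" "p' \<in> cw_arc c p q \<union> cw_arc c p' q'"
        using that assms by auto
      then show ?thesis using 4 by (auto simp: cw_arc_def split: if_splits)
    qed
    then show ?thesis using 4 assms by (auto simp: cw_arc_def circle_def)
  qed
qed

text \<open>Both conditions on pairs of arcs, no inclusion and no cover, have been expressed by the
  order of extremes, which an equivalence preserves.\<close>

lemma pca_model_equivalent:
  assumes M: "pca_model M" and "equivalent M M'" and "circ M' > 0"
    and circ': "\<And>A e. A \<in> arcs M' \<Longrightarrow> ext e A \<in> circle (circ M')"
  shows "pca_model M'"
proof -
  obtain f where f: "bij_betw f (arcs M) (arcs M')"
    and less: "\<And>A B e e'. A \<in> arcs M \<Longrightarrow> B \<in> arcs M \<Longrightarrow> ext e (f A) < ext e' (f B) \<longleftrightarrow> ext e A < ext e' B"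
    using assms(2) unfolding equivalent_def by blast
  have le: "ext e (f A) \<le> ext e' (f B) \<longleftrightarrow> ext e A \<le> ext e' B" if "A \<in> arcs M" "B \<in> arcs M" for A B e e'
    using less[OF that(2,1)] by (metis not_less)
  have circ: "\<And>A e. A \<in> arcs M \<Longrightarrow> ext e A \<in> circle (circ M)"
    and ne: "\<And>A. A \<in> arcs M \<Longrightarrow> ext S A \<noteq> ext T A"
    using M by (auto simp: pca_model_def)
  have surj: "arcs M' = f ` arcs M" using f by (auto simp: bij_betw_def)
  have fin: "finite (arcs M')" using M surj by (simp add: pca_model_def)
  have ne': "ext S (f A) \<noteq> ext T (f A)" if "A \<in> arcs M" for A
    using ne[OF that] less[OF that that, of S T] less[OF that that, of T S] by (auto simp: neq_iff)
  have mem: "f A \<in> arcs M'" if "A \<in> arcs M" for A using that surj by blast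
  have incl: "arc_points M' (f A) \<subseteq> arc_points M' (f B) \<longleftrightarrow> arc_points M A \<subseteq> arc_points M B"
    if A: "A \<in> arcs M" and B: "B \<in> arcs M" for A B
    unfolding arc_points_def
    using cw_arc_subset_iff[OF circ[OF A] circ[OF A] circ[OF B] circ[OF B] ne[OF A] ne[OF B]]
      cw_arc_subset_iff[OF circ'[OF mem[OF A]] circ'[OF mem[OF A]] circ'[OF mem[OF B]] circ'[OF mem[OF B]] ne'[OF A] ne'[OF B]]
    by (simp only: less le A B)
  have cover: "arc_points M' (f A) \<union> arc_points M' (f B) = circle (circ M')
      \<longleftrightarrow> arc_points M A \<union> arc_points M B = circle (circ M)"
    if A: "A \<in> arcs M" and B: "B \<in> arcs M" for A B
    unfolding arc_points_def
    using cw_arcs_cover_iff[OF circ[OF A] circ[OF A] circ[OF B] circ[OF B] ne[OF A] ne[OF B]]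
      cw_arcs_cover_iff[OF circ'[OF mem[OF A]] circ'[OF mem[OF A]] circ'[OF mem[OF B]] circ'[OF mem[OF B]] ne'[OF A] ne'[OF B]]
    by (simp only: less le A B)
  show ?thesis
    unfolding pca_model_def
  proof (intro conjI ballI impI allI)
    fix A' B' assume "A' \<in> arcs M'" "B' \<in> arcs M'" "A' \<noteq> B'"
    then obtain A B where AB: "A' = f A" "B' = f B" "A \<in> arcs M" "B \<in> arcs M" "A \<noteq> B"
      using surj by blast
    show "\<not> arc_points M' A' \<subseteq> arc_points M' B'"
      using M AB incl unfolding pca_model_def by blast
    show "arc_points M' A' \<union> arc_points M' B' \<noteq> circle (circ M')"
      using M AB cover unfolding pca_model_def by blast
  next
    fix A' assume "A' \<in> arcs M'"
    then obtain A where "A \<in> arcs M" "A' = f A" using surj by blast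
    then show "ext S A' \<noteq> ext T A'" using ne' by (simp only: not_False_eq_True)
  qed (use assms(3) fin circ' in simp_all)
qed

lemma equivalent_sym:
  assumes "equivalent M M'"
  shows "equivalent M' M"
proof -
  obtain f where f: "bij_betw f (arcs M) (arcs M')"
    and less: "\<And>A B e e'. A \<in> arcs M \<Longrightarrow> B \<in> arcs M \<Longrightarrow> ext e (f A) < ext e' (f B) \<longleftrightarrow> ext e A < ext e' B"
    using assms unfolding equivalent_def by blast
  let ?g = "inv_into (arcs M) f"
  have "bij_betw ?g (arcs M') (arcs M)" using f by (rule bij_betw_inv_into)
  moreover have "ext e (?g A) < ext e' (?g B) \<longleftrightarrow> ext e A < ext e' B"
    if "A \<in> arcs M'" "B \<in> arcs M'" for A B e e'
  proof -
    have "?g A \<in> arcs M" "?g B \<in> arcs M" using that calculation by (auto dest: bij_betwE)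
    then show ?thesis using less[of "?g A" "?g B"] bij_betw_inv_into_right[OF f] that by simp
  qed
  ultimately show ?thesis unfolding equivalent_def by blast
qed

section \<open>Following an infinitesimal motion\<close>

lemma eventually_affine_pos:
  fixes a b :: real
  assumes "a > 0"
  shows "\<forall>\<^sub>F \<epsilon> in at_right 0. a + \<epsilon> * b > 0"
proof -
  have "((\<lambda>\<epsilon>. a + \<epsilon> * b) \<longlongrightarrow> a + 0 * b) (at_right 0)" by (intro tendsto_intros)
  then show ?thesis using assms by (intro order_tendstoD(1)) auto
qed

text \<open>A slack constraint survives every sufficiently small motion; a tight one survives if its
  rate is \<open>0\<close>.\<close>

lemma eventually_affine_nonneg:
  fixes a b :: real
  assumes "a \<ge> 0" "a = 0 \<Longrightarrow> b = 0"
  shows "\<forall>\<^sub>F \<epsilon> in at_right 0. a + \<epsilon> * b \<ge> 0"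
proof (cases "a = 0")
  case False
  then show ?thesis using assms eventually_affine_pos[of a b] by (auto elim: eventually_mono)
qed (use assms in auto)

text \<open>With \<open>wraps\<close>, this writes a position as start plus
  \<open>turn * l - wraps * c\<close>. The two integers do not change along a small deformation, so
  positions depend linearly on the starts, \<open>l\<close> and \<open>c\<close>.\<close>

fun turn :: "kind \<Rightarrow> int" where
  "turn S = 0"
| "turn T = 1"

definition wraps :: "kind \<times> arc \<Rightarrow> int" where
  "wraps x = (if fst x = T \<and> snd (snd x) < fst (snd x) then 1 else 0)"

lemma pos_eq:
  assumes "u_ca_model c l d ds M" "x \<in> extremes M"
  shows "pos x = fst (snd x) + of_int (turn (fst x)) * l - of_int (wraps x) * c"
proof -
  obtain e A where x: "x = (e, A)" by (cases x)
  have "cw_len c (ext S A) (ext T A) = l"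
    using assms x unfolding u_ca_model_def extremes_def by blast
  then show ?thesis
    unfolding x by (cases e) (auto simp: pos_def wraps_def cw_len_def split: if_splits)
qed

lemma periodic_starts_u_ca_model:
  assumes u: "u_ca_model c l d ds M"
  shows "periodic_starts (fst ` arcs M) c l d ds"
proof
  have pca: "pca_model M" and c: "circ M = c" and "c > 0" "d > 0" "ds \<ge> 0"
    and starts: "\<And>A B. A \<in> arcs M \<Longrightarrow> B \<in> arcs M \<Longrightarrow> A \<noteq> B \<Longrightarrow> cw_len c (ext S A) (ext S B) \<ge> d + ds"
    using u unfolding u_ca_model_def by blast+
  show "c > 0" "d + ds > 0" using \<open>c > 0\<close> \<open>d > 0\<close> \<open>ds \<ge> 0\<close> by auto
  fix s s' and j :: int
  assume "s \<in> fst ` arcs M" "s' \<in> fst ` arcs M"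
  then obtain A B where AB: "A \<in> arcs M" "B \<in> arcs M" "s = fst A" "s' = fst B" by blast
  have mem: "(e, A) \<in> extremes M" "(e, B) \<in> extremes M" for e using AB by (auto simp: extremes_def)
  note circ = pos_in_circle[OF pca, unfolded c]
  show "\<bar>s' + of_int j * c - s\<bar> \<ge> d + ds" if "s \<noteq> s'"
  proof -
    have neq: "A \<noteq> B" "B \<noteq> A" using that AB by auto
    have "\<bar>ext S B - ext S A + of_int j * c\<bar> \<ge> d + ds"
      using circ[OF mem(1), of S] circ[OF mem(2), of S] starts[OF AB(1,2) neq(1)] starts[OF AB(2,1) neq(2)]
      by (intro abs_lift_diff_ge) (simp_all add: pos_def)
    then show ?thesis using AB by (simp add: algebra_simps)
  qed
  \<comment> \<open>The lift \<open>s + l\<close> of the end of \<open>A\<close> exceeds its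
    coordinate by \<open>wraps (T, A)\<close> turns, which are absorbed into \<open>j\<close>. The
    two extremes are distinct even if \<open>A = B\<close>.\<close>
  have "\<bar>pos (S, B) - pos (T, A) + of_int (j - wraps (T, A)) * c\<bar> \<ge> d"
    by (intro abs_lift_diff_ge circ mem u_ca_model_separated[OF u]) simp_all
  moreover have "pos (S, B) - pos (T, A) + of_int (j - wraps (T, A)) * c = s' + of_int j * c - l - s"
    using pos_eq[OF u mem(1), of T] AB by (simp add: pos_def algebra_simps)
  ultimately show "\<bar>s' + of_int j * c - l - s\<bar> \<ge> d" by simp
qed

context periodic_starts
begin

text \<open>Velocities that differ by a constant differ by a rotation, which changes no
  distance.\<close>

lemma infinitesimal_add_const: "infinitesimal \<phi> \<kappa> \<mu> \<Longrightarrow> infinitesimal (\<lambda>s. \<phi> s + C) \<kappa> \<mu>"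
  unfolding infinitesimal_def by (simp add: algebra_simps)

lemma infinitesimal_uminus: "infinitesimal \<phi> \<kappa> \<mu> \<Longrightarrow> infinitesimal (\<lambda>s. - \<phi> s) (- \<kappa>) (- \<mu>)"
  unfolding infinitesimal_def by (simp add: algebra_simps)

end

text \<open>Every extreme moves linearly. For small \<open>\<epsilon>\<close> the order survives
  because distinct extremes have distinct positions, slack constraints stay satisfied, and tight
  ones keep their value since \<open>infinitesimal\<close> makes their rate
  \<open>0\<close>.\<close>

lemma infinitesimal_deformation:
  assumes u: "u_ca_model c l d ds M"
    and inf: "periodic_starts.infinitesimal (fst ` arcs M) c l d ds \<phi> \<kappa> \<mu>"
  shows "\<exists>\<epsilon>>0. \<exists>M'. u_ca_model (c + \<epsilon> * \<kappa>) (l + \<epsilon> * \<mu>) d ds M' \<and> equivalent M' M"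
proof -
  interpret periodic_starts "fst ` arcs M" c l d ds
    using u by (rule periodic_starts_u_ca_model)
  have pca: "pca_model M" and c: "circ M = c" and pos: "c > 0" "l > 0" "d > 0" "ds \<ge> 0"
    and len: "\<And>A. A \<in> arcs M \<Longrightarrow> cw_len c (ext S A) (ext T A) = l"
    and starts: "\<And>A B. A \<in> arcs M \<Longrightarrow> B \<in> arcs M \<Longrightarrow> A \<noteq> B \<Longrightarrow> cw_len c (ext S A) (ext S B) \<ge> d + ds"
    using u unfolding u_ca_model_def by blast+
  note circ = pos_in_circle[OF pca, unfolded c]
  note separated = u_ca_model_separated[OF u]
  have fin: "finite (extremes M)" "finite (arcs M)"
    using finite_extremes[OF pca] pca by (auto simp: pca_model_def)
  txt \<open>The constant \<open>C\<close> rotates clockwise so that no extreme leaves \<open>[0, c)\<close> through \<open>0\<close>.\<close>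
  define C where "C = (\<Sum>s\<in>fst ` arcs M. \<bar>\<phi> s\<bar>) + \<bar>\<kappa>\<bar> + \<bar>\<mu>\<bar>"
  define \<psi> where "\<psi> s = \<phi> s + C" for s
  have \<psi>: "infinitesimal \<psi> \<kappa> \<mu>" unfolding \<psi>_def using inf by (rule infinitesimal_add_const)
  \<comment> \<open>The derivative of the position formula: \<open>s\<close>, \<open>l\<close> and
    \<open>c\<close> are replaced by their velocities.\<close>
  define v where "v x = \<psi> (fst (snd x)) + of_int (turn (fst x)) * \<mu> - of_int (wraps x) * \<kappa>" for x :: "kind \<times> arc"
  have v_nonneg: "v x \<ge> 0" if "x \<in> extremes M" for x
  proof -
    have "\<bar>\<phi> (fst (snd x))\<bar> \<le> (\<Sum>s\<in>fst ` arcs M. \<bar>\<phi> s\<bar>)"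
      using that fin(2) by (intro member_le_sum) (auto simp: extremes_def)
    then show ?thesis
      by (cases "fst x") (auto simp: v_def \<psi>_def C_def wraps_def)
  qed
  have distinct: "pos x \<noteq> pos y" if "x \<in> extremes M" "y \<in> extremes M" "x \<noteq> y" for x y
    using separated[OF that] \<open>d > 0\<close> by (auto simp: cw_len_def)
  \<comment> \<open>The number of turns that makes a coordinate difference a clockwise length; it
    depends on the order only and so is the same for the deformed model.\<close>
  define b where "b x y = (if pos x \<le> pos y then 0 else 1 :: int)" for x y
  have cw_len_b: "cw_len c (pos x) (pos y) = pos y - pos x + of_int (b x y) * c" for x y
    by (simp add: cw_len_def b_def)
  have rate_zero: "v y - v x + of_int (b x y) * \<kappa> = 0"
    if x: "x \<in> extremes M" and y: "y \<in> extremes M" and "x \<noteq> y" and eq: "cw_len c (pos x) (pos y) = d" for x y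
  proof -
    obtain e A e' B where xy: "x = (e, A)" "y = (e', B)" by (cases x, cases y)
    define J where "J = b x y - wraps y + wraps x"
    have AB: "fst A \<in> fst ` arcs M" "fst B \<in> fst ` arcs M" using x y xy by (auto simp: extremes_def)
    have eqJ: "fst B - fst A + of_int (turn e' - turn e) * l + of_int J * c = d"
      using eq cw_len_b[of x y] pos_eq[OF u x] pos_eq[OF u y] xy by (simp add: J_def algebra_simps)
    have vJ: "v y - v x + of_int (b x y) * \<kappa>
        = \<psi> (fst B) - \<psi> (fst A) + of_int (turn e' - turn e) * \<mu> + of_int J * \<kappa>"
      using xy by (simp add: v_def J_def algebra_simps)
    consider (same) "e = e'" | (ST) "e = S" "e' = T" | (TS) "e = T" "e' = S" by (cases e; cases e') auto
    then show ?thesis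
    proof cases
      case same
      then have "A \<noteq> B" using xy \<open>x \<noteq> y\<close> by auto
      then have neq: "fst A \<noteq> fst B"
        using distinct[of "(S, A)" "(S, B)"] x y xy by (auto simp: extremes_def pos_def)
      have D: "fst B + of_int J * c - fst A = d" using eqJ same by simp
      \<comment> \<open>Extremes of the same kind are at least \<open>d + ds\<close> apart, so at
        distance \<open>d\<close> the constraint on starts is tight and \<open>ds\<close>
        vanishes.\<close>
      then have "ds = 0" using gap[OF AB neq, of J] pos by simp
      then have "fst B + of_int J * c - fst A = d + ds" using D by simp
      then have "\<psi> (fst B) + of_int J * \<kappa> = \<psi> (fst A)"
        using \<psi> AB neq unfolding infinitesimal_def by blast
      then show ?thesis using vJ same by simp
    next
      case ST
      \<comment> \<open>Here the end of \<open>B\<close> follows the start of \<open>A\<close>, so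
        the constraint between an end and a start applies with \<open>A\<close> and \<open>B\<close>
        exchanged; its absolute value covers this side too.\<close>
      then have "fst A + of_int (- J) * c - l - fst B = - d" using eqJ by simp
      then have "\<bar>fst A + of_int (- J) * c - l - fst B\<bar> = d" using pos by linarith
      then have "\<psi> (fst A) + of_int (- J) * \<kappa> - \<mu> = \<psi> (fst B)"
        using \<psi> AB unfolding infinitesimal_def by blast
      then show ?thesis using vJ ST by simp
    next
      case TS
      then have "fst B + of_int J * c - l - fst A = d" using eqJ by simp
      then have "\<bar>fst B + of_int J * c - l - fst A\<bar> = d" using pos by linarith
      then have "\<psi> (fst B) + of_int J * \<kappa> - \<mu> = \<psi> (fst A)"
        using \<psi> AB unfolding infinitesimal_def by blast
      then show ?thesis using vJ TS by simp
    qed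
  qed
  have rate_zero_starts: "v y - v x + of_int (b x y) * \<kappa> = 0"
    if "A \<in> arcs M" "B \<in> arcs M" "A \<noteq> B" and x: "x = (S, A)" and y: "y = (S, B)"
      and eq: "cw_len c (pos x) (pos y) = d + ds" for A B x y
  proof -
    have neq: "fst A \<noteq> fst B"
      using distinct[of "(S, A)" "(S, B)"] that by (auto simp: extremes_def pos_def)
    have D: "fst B + of_int (b x y) * c - fst A = d + ds"
      using eq cw_len_b[of x y] by (simp add: x y pos_def)
    have "\<psi> (fst B) + of_int (b x y) * \<kappa> = \<psi> (fst A)"
      using \<psi> that(1,2) neq D unfolding infinitesimal_def by blast
    then show ?thesis by (simp add: v_def wraps_def x y)
  qed
  have ev1: "\<forall>\<^sub>F \<epsilon> in at_right 0. c + \<epsilon> * \<kappa> > 0 \<and> l + \<epsilon> * \<mu> > 0"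
    using pos by (intro eventually_conj eventually_affine_pos) auto
  have ev2: "\<forall>\<^sub>F \<epsilon> in at_right 0. \<forall>x\<in>extremes M. pos x + \<epsilon> * v x < c + \<epsilon> * \<kappa>"
  proof (intro eventually_ball_finite[OF fin(1)] ballI)
    fix x assume "x \<in> extremes M"
    then have "c - pos x > 0" using circ by (auto simp: circle_def)
    from eventually_affine_pos[OF this, of "\<kappa> - v x"]
    show "\<forall>\<^sub>F \<epsilon> in at_right 0. pos x + \<epsilon> * v x < c + \<epsilon> * \<kappa>"
      by (rule eventually_mono) (simp add: algebra_simps)
  qed
  have ev3: "\<forall>\<^sub>F \<epsilon> in at_right 0. \<forall>x\<in>extremes M. \<forall>y\<in>extremes M. pos x < pos y \<longrightarrow> pos x + \<epsilon> * v x < pos y + \<epsilon> * v y"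
  proof (intro eventually_ball_finite[OF fin(1)] ballI)
    fix x y assume "x \<in> extremes M" "y \<in> extremes M"
    show "\<forall>\<^sub>F \<epsilon> in at_right 0. pos x < pos y \<longrightarrow> pos x + \<epsilon> * v x < pos y + \<epsilon> * v y"
    proof (cases "pos x < pos y")
      case True
      then have "pos y - pos x > 0" by simp
      from eventually_affine_pos[OF this, of "v y - v x"] show ?thesis
        by (rule eventually_mono) (simp add: algebra_simps)
    qed simp
  qed
  have affine_ge: "\<forall>\<^sub>F \<epsilon> in at_right 0. (pos y + \<epsilon> * v y) - (pos x + \<epsilon> * v x) + of_int (b x y) * (c + \<epsilon> * \<kappa>) \<ge> D"
    if "cw_len c (pos x) (pos y) \<ge> D" "cw_len c (pos x) (pos y) = D \<Longrightarrow> v y - v x + of_int (b x y) * \<kappa> = 0" for x y D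
  proof -
    \<comment> \<open>Lengths are affine in \<open>\<epsilon>\<close>: the slack at \<open>0\<close>
      plus \<open>\<epsilon>\<close> times the rate.\<close>
    have "\<forall>\<^sub>F \<epsilon> in at_right 0. (cw_len c (pos x) (pos y) - D) + \<epsilon> * (v y - v x + of_int (b x y) * \<kappa>) \<ge> 0"
      using that by (intro eventually_affine_nonneg) auto
    then show ?thesis by (rule eventually_mono) (simp add: cw_len_b algebra_simps)
  qed
  have ev4: "\<forall>\<^sub>F \<epsilon> in at_right 0. \<forall>x\<in>extremes M. \<forall>y\<in>extremes M. x \<noteq> y \<longrightarrow>
      (pos y + \<epsilon> * v y) - (pos x + \<epsilon> * v x) + of_int (b x y) * (c + \<epsilon> * \<kappa>) \<ge> d"
  proof (intro eventually_ball_finite[OF fin(1)] ballI)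
    fix x y assume xy: "x \<in> extremes M" "y \<in> extremes M"
    show "\<forall>\<^sub>F \<epsilon> in at_right 0. x \<noteq> y \<longrightarrow>
      (pos y + \<epsilon> * v y) - (pos x + \<epsilon> * v x) + of_int (b x y) * (c + \<epsilon> * \<kappa>) \<ge> d"
    proof (cases "x = y")
      case False
      from affine_ge[OF separated[OF xy False] rate_zero[OF xy False]] show ?thesis by simp
    qed simp
  qed
  have ev5: "\<forall>\<^sub>F \<epsilon> in at_right 0. \<forall>A\<in>arcs M. \<forall>B\<in>arcs M. A \<noteq> B \<longrightarrow>
      (pos (S, B) + \<epsilon> * v (S, B)) - (pos (S, A) + \<epsilon> * v (S, A)) + of_int (b (S, A) (S, B)) * (c + \<epsilon> * \<kappa>) \<ge> d + ds"
  proof (intro eventually_ball_finite[OF fin(2)] ballI)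
    fix A B assume AB: "A \<in> arcs M" "B \<in> arcs M"
    show "\<forall>\<^sub>F \<epsilon> in at_right 0. A \<noteq> B \<longrightarrow>
      (pos (S, B) + \<epsilon> * v (S, B)) - (pos (S, A) + \<epsilon> * v (S, A)) + of_int (b (S, A) (S, B)) * (c + \<epsilon> * \<kappa>) \<ge> d + ds"
    proof (cases "A = B")
      case False
      have "cw_len c (pos (S, A)) (pos (S, B)) \<ge> d + ds" using starts[OF AB False] by (simp add: pos_def)
      from affine_ge[OF this rate_zero_starts[OF AB False refl refl]] show ?thesis by simp
    qed simp
  qed
  have "\<forall>\<^sub>F \<epsilon> in at_right (0::real). \<epsilon> > 0" by (simp add: eventually_at_right_less)
  then have "\<forall>\<^sub>F \<epsilon> in at_right 0. \<exists>M'. \<epsilon> > 0 \<and> u_ca_model (c + \<epsilon> * \<kappa>) (l + \<epsilon> * \<mu>) d ds M' \<and> equivalent M' M"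
    using ev1 ev2 ev3 ev4 ev5
  proof eventually_elim
    case (elim \<epsilon>)
    define c' l' where "c' = c + \<epsilon> * \<kappa>" and "l' = l + \<epsilon> * \<mu>"
    define \<rho> where "\<rho> x = pos x + \<epsilon> * v x" for x
    define f where "f A = (\<rho> (S, A), \<rho> (T, A))" for A
    define M' where "M' = \<lparr>circ = c', arcs = f ` arcs M\<rparr>"
    have arcs': "arcs M' = f ` arcs M" by (simp add: M'_def)
    have ext_f: "ext e (f A) = \<rho> (e, A)" for e A by (cases e) (simp_all add: f_def)
    have mem: "(e, A) \<in> extremes M" if "A \<in> arcs M" for e A using that by (simp add: extremes_def)
    have mono: "\<rho> x < \<rho> y" if "x \<in> extremes M" "y \<in> extremes M" "pos x < pos y" for x y
      using elim(4) that by (simp add: \<rho>_def)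
    have less: "\<rho> x < \<rho> y \<longleftrightarrow> pos x < pos y" if xy: "x \<in> extremes M" "y \<in> extremes M" for x y
    proof
      assume lt: "\<rho> x < \<rho> y"
      then have "\<not> pos y < pos x" "x \<noteq> y" using mono[OF xy(2,1)] by auto
      then show "pos x < pos y" using distinct[OF xy] by simp
    qed (rule mono[OF xy])
    have less_f: "ext e (f A) < ext e' (f B) \<longleftrightarrow> ext e A < ext e' B" if "A \<in> arcs M" "B \<in> arcs M" for A B e e'
      using less[OF mem[OF that(1)] mem[OF that(2)]] by (simp add: ext_f pos_def)
    have "inj_on f (arcs M)"
    proof (rule inj_onI, rule ccontr)
      fix A B assume AB: "A \<in> arcs M" "B \<in> arcs M" "f A = f B" "A \<noteq> B"
      then have "pos (S, A) \<noteq> pos (S, B)" using distinct mem by auto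
      then have "\<rho> (S, A) \<noteq> \<rho> (S, B)"
        using less[OF mem[OF AB(1)] mem[OF AB(2)]] less[OF mem[OF AB(2)] mem[OF AB(1)]] by (auto simp: neq_iff)
      then show False using AB(3) by (simp add: f_def)
    qed
    then have "bij_betw f (arcs M) (arcs M')" by (simp add: M'_def bij_betw_def)
    then have equiv: "equivalent M M'" unfolding equivalent_def using less_f by blast
    have circ': "ext e A' \<in> circle c'" if "A' \<in> arcs M'" for A' e
    proof -
      obtain A where A: "A \<in> arcs M" "A' = f A" using \<open>A' \<in> arcs M'\<close> unfolding arcs' by blast
      have "pos (e, A) \<ge> 0" using circ[OF mem[OF A(1)]] by (simp add: circle_def)
      then have "\<rho> (e, A) \<ge> 0" using v_nonneg[OF mem[OF A(1)], of e] elim(1) by (simp add: \<rho>_def)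
      moreover have "\<rho> (e, A) < c'" using elim(3) mem[OF A(1)] by (simp add: \<rho>_def c'_def)
      ultimately show ?thesis using A by (simp add: ext_f circle_def)
    qed
    have pca': "pca_model M'"
      using pca equiv by (rule pca_model_equivalent) (use elim(2) circ' in \<open>simp_all add: M'_def c'_def\<close>)
    have cw_len': "cw_len c' (\<rho> x) (\<rho> y) = \<rho> y - \<rho> x + of_int (b x y) * c'"
      if "x \<in> extremes M" "y \<in> extremes M" for x y
    proof -
      have "\<rho> x \<le> \<rho> y \<longleftrightarrow> pos x \<le> pos y" using less[OF that(2,1)] by (simp flip: not_less)
      then show ?thesis by (simp add: cw_len_def b_def)
    qed
    have "cw_len c' (ext S A') (ext T A') = l'" if "A' \<in> arcs M'" for A'
    proof -
      obtain A where A: "A \<in> arcs M" "A' = f A" using \<open>A' \<in> arcs M'\<close> unfolding arcs' by blast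
      define w where "w = wraps (T, A)"
      have b: "b (S, A) (T, A) = w" by (simp add: w_def b_def wraps_def pos_def)
      then have "pos (T, A) - pos (S, A) + of_int w * c = l"
        using len[OF A(1)] cw_len_b[of "(S, A)" "(T, A)"] by (simp add: pos_def)
      \<comment> \<open>The \<open>wraps\<close> terms cancel, so every arc length changes at the
        common rate \<open>\<mu>\<close>.\<close>
      moreover have "v (T, A) - v (S, A) + of_int w * \<kappa> = \<mu>"
        by (simp add: v_def w_def wraps_def)
      moreover have "\<rho> (T, A) - \<rho> (S, A) + of_int w * c'
          = (pos (T, A) - pos (S, A) + of_int w * c) + \<epsilon> * (v (T, A) - v (S, A) + of_int w * \<kappa>)"
        by (simp add: \<rho>_def c'_def algebra_simps)
      ultimately show ?thesis
        using cw_len'[OF mem[OF A(1)] mem[OF A(1)], of S T] b unfolding A(2) ext_f l'_def by simp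
    qed
    moreover have "cw_len c' (pos x') (pos y') \<ge> d" if "consecutive M' x' y'" for x' y'
    proof -
      have "x' \<in> extremes M'" "y' \<in> extremes M'" "x' \<noteq> y'" using that by (simp_all add: consecutive_def)
      then obtain e A e' B where AB: "A \<in> arcs M" "B \<in> arcs M"
        and xy: "x' = (e, f A)" "y' = (e', f B)" "(e, A) \<noteq> (e', B)"
        unfolding extremes_def arcs' by blast
      have "cw_len c' (\<rho> (e, A)) (\<rho> (e', B)) \<ge> d"
        unfolding cw_len'[OF mem[OF AB(1)] mem[OF AB(2)]] unfolding \<rho>_def c'_def
        by (rule elim(5)[rule_format, OF mem[OF AB(1)] mem[OF AB(2)] xy(3)])
      moreover have "pos x' = \<rho> (e, A)" "pos y' = \<rho> (e', B)"
        unfolding xy pos_def fst_conv snd_conv by (rule ext_f)+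
      ultimately show ?thesis by simp
    qed
    moreover have "cw_len c' (ext S A') (ext S B') \<ge> d + ds"
      if "A' \<in> arcs M'" "B' \<in> arcs M'" "A' \<noteq> B'" for A' B'
    proof -
      obtain A B where AB: "A \<in> arcs M" "B \<in> arcs M" "A' = f A" "B' = f B" "A \<noteq> B"
        using \<open>A' \<in> arcs M'\<close> \<open>B' \<in> arcs M'\<close> \<open>A' \<noteq> B'\<close> unfolding arcs' by blast
      show ?thesis
        unfolding AB(3,4) ext_f cw_len'[OF mem[OF AB(1)] mem[OF AB(2)]] unfolding \<rho>_def c'_def
        by (rule elim(6)[rule_format, OF AB(1,2,5)])
    qed
    ultimately have "u_ca_model c' l' d ds M'"
      unfolding u_ca_model_def using elim(2) pos pca' by (simp add: c'_def l'_def M'_def)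
    then show ?case using elim(1) equivalent_sym[OF equiv] unfolding c'_def l'_def by blast
  qed
  then have "\<exists>\<epsilon>. \<exists>M'. \<epsilon> > 0 \<and> u_ca_model (c + \<epsilon> * \<kappa>) (l + \<epsilon> * \<mu>) d ds M' \<and> equivalent M' M"
    by (rule eventually_happens'[rotated]) simp
  then show ?thesis by blast
qed

section \<open>Minimality forces rigidity\<close>

theorem theorem11:
  fixes c l d ds :: real and U :: ca_model
  assumes "d > 0" and "ds \<ge> 0"
    and "minimal_ca_model c l d ds U"
  shows "\<exists>a b a' b' :: int.
           l = of_int a * d + of_int b * ds \<and> c = of_int a' * d + of_int b' * ds"
proof -
  have u: "u_ca_model c l d ds U"
    using assms(3) by (simp add: minimal_ca_model_def)
  interpret periodic_starts "fst ` arcs U" c l d ds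
    using u by (rule periodic_starts_u_ca_model)
  \<comment> \<open>The deformed model is equivalent to \<open>U\<close> and keeps \<open>d\<close>
    and \<open>ds\<close>, so minimality forbids a decrease of \<open>c\<close> or
    \<open>l\<close>.\<close>
  have nonneg: "\<kappa> \<ge> 0 \<and> \<mu> \<ge> 0" if inf: "infinitesimal \<phi> \<kappa> \<mu>" for \<phi> \<kappa> \<mu>
  proof -
    obtain \<epsilon> M' where "\<epsilon> > 0" "u_ca_model (c + \<epsilon> * \<kappa>) (l + \<epsilon> * \<mu>) d ds M'" "equivalent M' U"
      using infinitesimal_deformation[OF u inf] by blast
    then have "l \<le> l + \<epsilon> * \<mu> \<and> c \<le> c + \<epsilon> * \<kappa>"
      using assms(3) unfolding minimal_ca_model_def by blast
    then show ?thesis using \<open>\<epsilon> > 0\<close> by (simp add: zero_le_mult_iff)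
  qed
  \<comment> \<open>The opposite motion is infinitesimal as well, so both velocities are also at
    most \<open>0\<close>.\<close>
  have "\<kappa> = 0 \<and> \<mu> = 0" if "infinitesimal \<phi> \<kappa> \<mu>" for \<phi> \<kappa> \<mu>
    using nonneg[OF that] nonneg[OF infinitesimal_uminus[OF that]] by simp
  then show ?thesis by (rule rigid_imp_integer_combination)
qed

end
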